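(* For every positive integer $k$, the graph $G_k$ is $k$-connected.
   Context: Graphs are finite and simple. A graph $G$ is $k$-connected if $|V(G)|>k$ and deleting any set of at most $k-1$ vertices leaves the graph connected. The graph $G_k$: let $Q=\mathbb{F}_2^3$, with elements written as binary triples and addition coordinatewise modulo $2$. Put $P_0=\{100,010\}$, $P_1=\{001,110,101\}$, $P_2=\{011,111\}$; these form a partition of $Q\setminus\{000\}$. For a positive integer $k$, the vertex set of $G_k$ is $Q\times\{0,1,2\}\times\{1,\ldots,k\}$, where the vertex $(x,i,r)$ is written $x_i^{(r)}$. The edges are: (i) internal edges: for every $x\in Q$ and $r\in\{1,\ldots,k\}$, the vertices $x_0^{(r)},x_1^{(r)},x_2^{(r)}$ are pairwise adjacent; (ii) external edges: if $x,y\in Q$ are distinct, $r,s\in\{1,\ldots,k\}$, $i\in\{0,1,2\}$ and $x+y\in P_i$, then $x_i^{(r)}$ and $y_i^{(s)}$ are adjacent. There are no other edges. *)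

theory Defs
  imports "Graph_Theory.Graph_Theory" "HOL-Library.Z2" "HOL-Library.Product_Plus"
begin

text \<open>
  A finite simple graph is an instance of the locale \<^locale>\<open>graph\<close>: each undirected edge
  is a pair of opposite arcs. \<open>card S < k\<close> says ``at most \<open>k - 1\<close> vertices'' without
  truncated subtraction.
\<close>

definition k_connected :: "nat \<Rightarrow> ('a, 'b) pre_digraph \<Rightarrow> bool" where
  "k_connected k G \<longleftrightarrow>
     card (verts G) > k \<and>
     (\<forall>S. S \<subseteq> verts G \<longrightarrow> finite S \<longrightarrow> card S < k \<longrightarrow> connected (G \<restriction> (verts G - S)))"

type_synonym F2_cubed = "bit \<times> bit \<times> bit"

definition part :: "nat \<Rightarrow> F2_cubed set" where
  "part i = (if i = 0 then {(1,0,0), (0,1,0)}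
             else if i = 1 then {(0,0,1), (1,1,0), (1,0,1)}
             else if i = 2 then {(0,1,1), (1,1,1)}
             else {})"

lemma part_partition:
  "part 0 \<union> part 1 \<union> part 2 = UNIV - {(0,0,0)}"
  "part 0 \<inter> part 1 = {}" "part 0 \<inter> part 2 = {}" "part 1 \<inter> part 2 = {}"
proof -
  have "x \<in> part 0 \<union> part 1 \<union> part 2 \<longleftrightarrow> x \<in> UNIV - {(0,0,0)}" for x
  proof -
    obtain a b c where "x = (a, b, c)"
      by (cases x)
    then show ?thesis
      by (cases a; cases b; cases c) (simp_all add: part_def)
  qed
  then show "part 0 \<union> part 1 \<union> part 2 = UNIV - {(0,0,0)}"
    by (rule set_eqI)
qed (auto simp: part_def)

text \<open>The triple \<open>(x, i, r)\<close> is the vertex written $x_i^{(r)}$.\<close>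

type_synonym vertex = "F2_cubed \<times> nat \<times> nat"

definition vertices :: "nat \<Rightarrow> vertex set" where
  "vertices k = UNIV \<times> {0, 1, 2} \<times> {1..k}"

definition internal_edges :: "nat \<Rightarrow> vertex rel" where
  "internal_edges k =
     {((x, i, r), (x, j, r)) | x i j r. i \<in> {0, 1, 2} \<and> j \<in> {0, 1, 2} \<and> i \<noteq> j \<and> r \<in> {1..k}}"

definition external_edges :: "nat \<Rightarrow> vertex rel" where
  "external_edges k =
     {((x, i, r), (y, i, s)) | x y i r s.
        x \<noteq> y \<and> i \<in> {0, 1, 2} \<and> r \<in> {1..k} \<and> s \<in> {1..k} \<and> x + y \<in> part i}"

definition graph_G :: "nat \<Rightarrow> vertex pair_pre_digraph" where
  "graph_G k = \<lparr>pverts = vertices k, parcs = internal_edges k \<union> external_edges k\<rparr>"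

lemma finite_vertices: "finite (vertices k)"
proof -
  have "(UNIV :: bit set) = {0, 1}"
    using bit.exhaust by auto
  then have bit: "finite (UNIV :: bit set)"
    by (rule ssubst) (intro finite.intros)
  have "finite (UNIV \<times> UNIV \<times> UNIV :: F2_cubed set)"
    by (intro finite_cartesian_product bit)
  then have "finite (UNIV :: F2_cubed set)"
    unfolding UNIV_Times_UNIV .
  then show ?thesis
    unfolding vertices_def
    by (rule finite_cartesian_product)
      (intro finite_cartesian_product finite.intros finite_atLeastAtMost)
qed

lemma pair_graph_graph_G: "pair_graph (graph_G k)"
proof
  have sub: "parcs (graph_G k) \<subseteq> pverts (graph_G k) \<times> pverts (graph_G k)"
    unfolding graph_G_def vertices_def internal_edges_def external_edges_def
      pair_pre_digraph.simps by blast
  show fin: "finite (pverts (graph_G k))"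
    by (simp add: graph_G_def finite_vertices)
  show "finite (parcs (graph_G k))"
    by (rule finite_subset[OF sub finite_cartesian_product[OF fin fin]])
  show "fst e \<in> pverts (graph_G k)" "snd e \<in> pverts (graph_G k)" if "e \<in> parcs (graph_G k)" for e
    using sub that by auto
  show "fst e \<noteq> snd e" if "e \<in> parcs (graph_G k)" for e
    using that unfolding graph_G_def internal_edges_def external_edges_def
      pair_pre_digraph.simps by fastforce
  have "sym (internal_edges k)"
    by (rule symI) (auto simp: internal_edges_def)
  moreover have "sym (external_edges k)"
  proof (rule symI)
    fix u v
    assume "(u, v) \<in> external_edges k"
    then obtain x y i r s where uv: "u = (x, i, r)" "v = (y, i, s)"
      and "x \<noteq> y" "i \<in> {0, 1, 2}" "r \<in> {1..k}" "s \<in> {1..k}" "x + y \<in> part i"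
      unfolding external_edges_def by blast
    moreover from this have "y \<noteq> x" "y + x \<in> part i"
      by (simp_all only: add.commute[of y x] not_sym not_False_eq_True)
    ultimately show "(v, u) \<in> external_edges k"
      unfolding external_edges_def by blast
  qed
  ultimately show "symmetric (with_proj (graph_G k))"
    by (simp add: symmetric_def graph_G_def sym_Un)
qed

lemma graph_graph_G: "graph (with_proj (graph_G k))"
proof -
  interpret pair_graph "graph_G k"
    by (rule pair_graph_graph_G)
  show ?thesis
    by unfold_locales
qed

end

theory Submission
  imports Defs
begin

text \<open>
  Call the vertices with third coordinate \<open>r\<close> the \<open>r\<close>-th layer.  Fewer than \<open>k\<close> deleted vertices
  cannot meet all \<open>k\<close> layers, so some layer \<open>r\<close> survives intact (\<open>untouched_layer\<close>), and two facts
  make it a connected hub for all other surviving vertices.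

  First, an intact layer is connected: the three parts cover the nonzero elements of \<open>Q\<close>, so the
  internal triangles over any two distinct \<open>x, y\<close> are joined by an external edge inside the layer
  (\<open>layer_reachable\<close>).  Secondly, external edges ignore layers and every part is nonempty, so each
  vertex \<open>(x, i, s)\<close>, whatever its layer, is adjacent to a vertex \<open>(y, i, r)\<close> of the intact layer
  (\<open>neighbour_in_layer\<close>).
\<close>

lemma F2_cubed_add_self: "(x :: F2_cubed) + x = 0"
proof -
  obtain a b c where "x = (a, b, c)"
    by (cases x)
  then show ?thesis
    by (cases a; cases b; cases c) (simp_all add: zero_prod_def)
qed

lemma distinct_sum_in_part:
  assumes "x \<noteq> y"
  obtains i where "i \<in> {0, 1, 2}" "x + y \<in> part i"
proof -
  have "x + y \<noteq> 0"
  proof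
    assume "x + y = 0"
    then have "x + y = x + x"
      by (simp only: F2_cubed_add_self)
    then show False
      using assms by (metis add_left_cancel)
  qed
  then have "x + y \<in> part 0 \<union> part 1 \<union> part 2"
    unfolding part_partition zero_prod_def by blast
  then show thesis
    using that by blast
qed

lemma sum_in_part_witness:
  assumes "i \<in> {0, 1, 2}"
  obtains y where "x \<noteq> y" "x + y \<in> part i"
proof -
  have "part i \<noteq> {}"
    using assms by (auto simp: part_def)
  then obtain d where d: "d \<in> part i"
    by blast
  with assms part_partition(1) have "d \<noteq> 0"
    unfolding zero_prod_def by blast
  moreover have "x + (x + d) = d"
    unfolding add.assoc[symmetric] F2_cubed_add_self by (rule add_0_left)
  ultimately show thesis
    using d that[of "x + d"] by (metis add.right_neutral add_left_cancel)
qed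

lemma untouched_layer:
  fixes S :: "vertex set"
  assumes "finite S" "card S < k"
  obtains r where "r \<in> {1..k}" "\<And>x i. (x, i, r) \<notin> S"
proof -
  let ?L = "(\<lambda>(x, i, r). r) ` S"
  have "card ?L < card {1..k}"
    using card_image_le[OF assms(1), of "\<lambda>(x, i, r). r"] assms(2) by simp
  then have "\<not> {1..k} \<subseteq> ?L"
    using assms(1) card_mono by (metis finite_imageI not_le)
  then obtain r where "r \<in> {1..k}" "r \<notin> ?L"
    by blast
  with that show thesis
    by force
qed

lemma neighbour_in_layer:
  assumes "(x, i, s) \<in> vertices k" "r \<in> {1..k}"
  obtains y where "((x, i, s), (y, i, r)) \<in> external_edges k"
proof -
  have i: "i \<in> {0, 1, 2}" and "s \<in> {1..k}"
    using assms(1) by (auto simp: vertices_def)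
  moreover obtain y where "x \<noteq> y" "x + y \<in> part i"
    using sum_in_part_witness[OF i] .
  ultimately show thesis
    using assms(2) that unfolding external_edges_def by blast
qed

lemma arcs_ends_induce_graph_G:
  "arcs_ends (with_proj (graph_G k) \<restriction> W) = (internal_edges k \<union> external_edges k) \<inter> W \<times> W"
  by (auto simp: arcs_ends_conv graph_G_def)

text \<open>
  Between triangles over distinct \<open>x, y\<close> a single external edge inside the layer exists, and only at
  the index \<open>l\<close> of the part containing \<open>x + y\<close>; the two triangles supply the detours from \<open>i\<close> to \<open>l\<close>
  and from \<open>l\<close> to \<open>j\<close>.  Everything happens inside the layer, so the result holds in any induced
  subgraph that contains it.
\<close>

lemma layer_reachable:
  assumes r: "r \<in> {1..k}"
    and layer: "UNIV \<times> {0, 1, 2} \<times> {r} \<subseteq> W"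
    and i: "i \<in> {0, 1, 2}" and j: "j \<in> {0, 1, 2}"
  shows "(x, i, r) \<rightarrow>\<^sup>*\<^bsub>with_proj (graph_G k) \<restriction> W\<^esub> (y, j, r)"
proof -
  interpret G: pair_graph "graph_G k"
    by (rule pair_graph_graph_G)
  let ?H = "with_proj (graph_G k) \<restriction> W"
  interpret H: wf_digraph ?H
    by (rule G.wellformed_induce_subgraph)
  have in_W: "(z, l, r) \<in> W" if "l \<in> {0, 1, 2}" for z l
    using layer that by blast
  have triangle: "(z, l, r) \<rightarrow>\<^sup>*\<^bsub>?H\<^esub> (z, m, r)"
    if "l \<in> {0, 1, 2}" "m \<in> {0, 1, 2}" for z l m
  proof (cases "l = m")
    case True
    then show ?thesis
      using in_W that by simp
  next
    case False
    then have "((z, l, r), (z, m, r)) \<in> internal_edges k"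
      using that r unfolding internal_edges_def by blast
    then have "(z, l, r) \<rightarrow>\<^bsub>?H\<^esub> (z, m, r)"
      using in_W that unfolding arcs_ends_induce_graph_G by blast
    then show ?thesis
      by (rule H.reachable_adjI)
  qed
  show ?thesis
  proof (cases "x = y")
    case True
    then show ?thesis
      using triangle i j by simp
  next
    case False
    then obtain l where l: "l \<in> {0, 1, 2}" "x + y \<in> part l"
      by (rule distinct_sum_in_part)
    have "(x, i, r) \<rightarrow>\<^sup>*\<^bsub>?H\<^esub> (x, l, r)"
      using i l(1) by (rule triangle)
    also have "((x, l, r), (y, l, r)) \<in> external_edges k"
      using False l r unfolding external_edges_def by blast
    then have "(x, l, r) \<rightarrow>\<^bsub>?H\<^esub> (y, l, r)"
      using in_W l(1) unfolding arcs_ends_induce_graph_G by blast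
    also have "(y, l, r) \<rightarrow>\<^sup>*\<^bsub>?H\<^esub> (y, j, r)"
      using l(1) j by (rule triangle)
    finally show ?thesis .
  qed
qed

text \<open>
  Arcs can be reversed, so two vertices that reach the same \<open>c\<close> are linked through it; only walks
  towards one vertex have to be constructed.
\<close>

lemma connected_if_hub:
  assumes "sym_digraph H" and c: "c \<in> verts H"
    and hub: "\<And>v. v \<in> verts H \<Longrightarrow> v \<rightarrow>\<^sup>*\<^bsub>H\<^esub> c"
  shows "connected H"
proof -
  interpret H: sym_digraph H
    by (rule assms(1))
  have "u \<rightarrow>\<^sup>*\<^bsub>H\<^esub> v" if "u \<in> verts H" "v \<in> verts H" for u v
    using hub[OF that(1)] symmetric_reachable[OF H.sym_arcs hub[OF that(2)]]
    by (rule H.reachable_trans)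
  then have "u \<rightarrow>\<^sup>*\<^bsub>mk_symmetric H\<^esub> v" if "u \<in> verts H" "v \<in> verts H" for u v
    using that by (intro H.reachable_mk_symmetricI)
  moreover have "verts (mk_symmetric H) = verts H"
    by (simp add: mk_symmetric_def)
  ultimately show ?thesis
    unfolding connected_def strongly_connected_def using c by (metis empty_iff)
qed

lemma card_vertices_gt:
  assumes "k \<ge> 1"
  shows "k < card (vertices k)"
proof -
  \<comment> \<open>The vertices over the single element \<open>0\<close> of \<open>Q\<close> already number \<open>3 * k\<close>.\<close>
  have "k < card ({0 :: F2_cubed} \<times> {0, 1, 2 :: nat} \<times> {1..k})"
    using assms by (simp add: card_cartesian_product)
  also have "\<dots> \<le> card (vertices k)"
    by (rule card_mono[OF finite_vertices]) (auto simp: vertices_def)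
  finally show ?thesis .
qed

theorem lemma2:
  fixes k :: nat
  assumes "k \<ge> 1"
  shows "k_connected k (with_proj (graph_G k))"
proof -
  interpret G: pair_graph "graph_G k"
    by (rule pair_graph_graph_G)
  have verts: "verts (with_proj (graph_G k)) = vertices k"
    by (simp add: graph_G_def)
  have "connected (with_proj (graph_G k) \<restriction> (vertices k - S))"
    if S: "finite S" "card S < k" for S
  proof -
    let ?W = "vertices k - S"
    let ?H = "with_proj (graph_G k) \<restriction> ?W"
    obtain r where r: "r \<in> {1..k}" and untouched: "\<And>x i. (x, i, r) \<notin> S"
      using untouched_layer[OF S] by blast
    have layer: "UNIV \<times> {0, 1, 2} \<times> {r} \<subseteq> ?W"
      using r untouched by (auto simp: vertices_def)
    have induced: "induced_subgraph ?H (with_proj (graph_G k))"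
      using verts by (intro G.induced_induce) auto
    interpret H: sym_digraph ?H
      using induced by (rule G.induced_graph_imp_graph)
    let ?c = "(0, 0, r) :: vertex"
    have "v \<rightarrow>\<^sup>*\<^bsub>?H\<^esub> ?c" if v: "v \<in> verts ?H" for v
    proof -
      obtain x i s where v_eq: "v = (x, i, s)"
        by (cases v)
      with v have v_in: "(x, i, s) \<in> ?W" "(x, i, s) \<in> vertices k" and i: "i \<in> {0, 1, 2}"
        by (auto simp: vertices_def)
      obtain y where "((x, i, s), (y, i, r)) \<in> external_edges k"
        using neighbour_in_layer[OF v_in(2) r] .
      moreover have "(y, i, r) \<in> ?W"
        using layer i by blast
      ultimately have "v \<rightarrow>\<^bsub>?H\<^esub> (y, i, r)"
        using v_in(1) unfolding arcs_ends_induce_graph_G v_eq by blast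
      also have "(y, i, r) \<rightarrow>\<^sup>*\<^bsub>?H\<^esub> ?c"
        using r layer i by (intro layer_reachable) auto
      finally show ?thesis .
    qed
    moreover have "?c \<in> verts ?H"
      using layer by auto
    ultimately show ?thesis
      by (intro connected_if_hub H.sym_digraph_axioms)
  qed
  then show ?thesis
    unfolding k_connected_def verts using card_vertices_gt[OF assms] by blast
qed

end
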